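(* Let $N>2$. Suppose that the dynamics are deterministic, i.e. for each $s\in S$, $a\in A_s$ and $t=1,\dots,N-1$ there exists $s^{+}\in S$ such that $p_t(s^{+}\mid s,a)=1$. Then $F_t(s)\subseteq V_t(s)$ for all $s\in S$ and all $t<N$.
   Context: Setting (vector-valued Markov decision process). Integers $N$ and $m\ge1$ are fixed. $S$ is a finite set of states; for each $s\in S$, $A_s$ is a nonempty compact set of actions; $A=\bigcup_{s\in S}A_s$. For $t=1,\dots,N-1$, $s\in S$, $a\in A_s$, $R_t(s,a)\in\mathbb{R}^m$ is a vector reward, with components continuous in $a\in A_s$; $p_t(j\mid s,a)$ is the probability of state $j\in S$ at epoch $t+1$ given action $a$ in state $s$ at epoch $t$, continuous in $a\in A_s$. $R_N(s)\in\mathbb{R}^m$ is the terminal reward. A Markovian decision rule is a map $d:S\to A$ with $d(s)\in A_s$; the set $D$ of decision rules is assumed compact (topology of pointwise convergence). A (Markovian) policy is a sequence $\pi=(d_1,\dots,d_{N-1})$ of decision rules; $P_W$ is the set of all of them. Expected total rewards: $u_N^\pi(s)=R_N(s)$ and, for $t<N$, $u_t^\pi(s)=R_t(s,d_t(s))+\sum_{j\in S}p_t(j\mid s,d_t(s))\,u_{t+1}^\pi(j)$. Set $V_t(s)=\{u_t^\pi(s):\pi\in P_W\}$ for $t\le N$, $s\in S$. Order on $\mathbb{R}^m$: $x\ge y$ iff $x_i\ge y_i$ for all $i$. For $X\subseteq\mathbb{R}^m$, $e(X)=\{x\in X:\forall y\in X,\ y\ge x\Rightarrow y=x\}$. White's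 equations: define by backward recursion $U_N(s)=\{R_N(s)\}$ and, for $t<N$, $$F_t(s)=\bigl\{R_t(s,a)+\textstyle\sum_{j\in S}p_t(j\mid s,a)v_j : a\in A_s,\ v_j\in U_{t+1}(j)\ \text{for all } j\in S\bigr\},\qquad U_t(s)=e(F_t(s)).$$ *)

theory Defs
  imports "HOL-Analysis.Analysis"
begin

text \<open>The order on \<^typ>\<open>real ^ 'm\<close> is the componentwise one (\<open>less_eq_vec_def\<close>).\<close>

definition efficient :: "(real ^ 'm) set \<Rightarrow> (real ^ 'm) set" where
  "efficient X = {x \<in> X. \<forall>y\<in>X. x \<le> y \<longrightarrow> y = x}"

definition decision_rules :: "'s set \<Rightarrow> ('s \<Rightarrow> 'a set) \<Rightarrow> ('s \<Rightarrow> 'a) set" where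
  "decision_rules S A = (\<Pi>\<^sub>E s\<in>S. A s)"

text \<open>
  Decision epochs are \<open>1, \<dots>, N - 1\<close>. The term \<open>p t j s a\<close> is the probability of
  state \<open>j\<close> at epoch \<open>t + 1\<close> given action \<open>a\<close> in state \<open>s\<close> at epoch \<open>t\<close>, and \<open>RN\<close> is
  the terminal reward.
\<close>

locale vector_mdp =
  fixes N :: nat
    and S :: "'s set"
    and A :: "'s \<Rightarrow> 'a::topological_space set"
    and R :: "nat \<Rightarrow> 's \<Rightarrow> 'a \<Rightarrow> real ^ 'm"
    and p :: "nat \<Rightarrow> 's \<Rightarrow> 's \<Rightarrow> 'a \<Rightarrow> real"
    and RN :: "'s \<Rightarrow> real ^ 'm"
  assumes finite_states: "finite S"
    and actions_nonempty: "\<And>s. s \<in> S \<Longrightarrow> A s \<noteq> {}"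
    and actions_compact: "\<And>s. s \<in> S \<Longrightarrow> compact (A s)"
    and reward_continuous:
      "\<And>t s i. t \<in> {1..<N} \<Longrightarrow> s \<in> S \<Longrightarrow> continuous_on (A s) (\<lambda>a. R t s a $ i)"
    and prob_nonneg:
      "\<And>t s a j. t \<in> {1..<N} \<Longrightarrow> s \<in> S \<Longrightarrow> a \<in> A s \<Longrightarrow> j \<in> S \<Longrightarrow> 0 \<le> p t j s a"
    and prob_sum:
      "\<And>t s a. t \<in> {1..<N} \<Longrightarrow> s \<in> S \<Longrightarrow> a \<in> A s \<Longrightarrow> (\<Sum>j\<in>S. p t j s a) = 1"
    and prob_continuous:
      "\<And>t s j. t \<in> {1..<N} \<Longrightarrow> s \<in> S \<Longrightarrow> j \<in> S \<Longrightarrow> continuous_on (A s) (\<lambda>a. p t j s a)"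
    and decision_rules_compact:
      "compactin (product_topology (\<lambda>_. euclidean) S) (decision_rules S A)"
begin

definition policies :: "(nat \<Rightarrow> 's \<Rightarrow> 'a) set" where
  "policies = (\<Pi>\<^sub>E t\<in>{1..<N}. decision_rules S A)"

text \<open>The backward recursions below start at \<open>t = N\<close>; their values for \<open>t > N\<close> are junk.\<close>

function total_reward :: "(nat \<Rightarrow> 's \<Rightarrow> 'a) \<Rightarrow> nat \<Rightarrow> 's \<Rightarrow> real ^ 'm" where
  "total_reward \<pi> t s =
    (if N \<le> t then RN s
     else R t s (\<pi> t s) + (\<Sum>j\<in>S. p t j s (\<pi> t s) *\<^sub>R total_reward \<pi> (t + 1) j))"
  by pat_completeness auto
termination
  by (relation "Wellfounded.measure (\<lambda>(\<pi>, t, s). N - t)") auto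

declare total_reward.simps [simp del]

definition V :: "nat \<Rightarrow> 's \<Rightarrow> (real ^ 'm) set" where
  "V t s = {total_reward \<pi> t s | \<pi>. \<pi> \<in> policies}"

definition one_step :: "nat \<Rightarrow> ('s \<Rightarrow> (real ^ 'm) set) \<Rightarrow> 's \<Rightarrow> (real ^ 'm) set" where
  "one_step t W s =
    {R t s a + (\<Sum>j\<in>S. p t j s a *\<^sub>R v j) | a v. a \<in> A s \<and> (\<forall>j\<in>S. v j \<in> W j)}"

function U :: "nat \<Rightarrow> 's \<Rightarrow> (real ^ 'm) set" where
  "U t s = (if N \<le> t then {RN s} else efficient (one_step t (\<lambda>j. U (t + 1) j) s))"
  by pat_completeness auto
termination
  by (relation "Wellfounded.measure (\<lambda>(t, s). N - t)") auto

declare U.simps [simp del]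

definition F :: "nat \<Rightarrow> 's \<Rightarrow> (real ^ 'm) set" where
  "F t s = one_step t (U (t + 1)) s"

end

end

theory Submission
  imports Defs
begin

text \<open>
  A one-step Bellman expression at \<open>(t, s)\<close> combines continuations \<open>v j\<close> that, for different
  states \<open>j\<close>, may come from different policies, and no single policy need realise them all. Under
  deterministic dynamics only the continuation at the successor of \<open>s\<close> carries weight, so one
  policy suffices, and prescribing \<open>a\<close> at \<open>(t, s)\<close> leaves its rewards from epoch \<open>t + 1\<close> unchanged.
\<close>

text \<open>The weights other than \<open>q k\<close> are nonnegative and sum to 0, so each of them
  vanishes.\<close>

lemma sum_scaleR_point_mass:
  fixes q :: "'s \<Rightarrow> real" and f :: "'s \<Rightarrow> 'b::real_vector"
  assumes "finite S" and "\<And>j. j \<in> S \<Longrightarrow> 0 \<le> q j" and "sum q S = 1"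
    and "k \<in> S" and "q k = 1"
  shows "(\<Sum>j\<in>S. q j *\<^sub>R f j) = f k"
proof -
  have "sum q (S - {k}) = 0"
    using assms by (simp add: sum_diff1)
  then have "q j = 0" if "j \<in> S - {k}" for j
    using that assms(1,2) by (subst (asm) sum_nonneg_eq_0_iff) auto
  then have "(\<Sum>j\<in>S. q j *\<^sub>R f j) = (\<Sum>j\<in>{k}. q j *\<^sub>R f j)"
    using assms(1,4) by (intro sum.mono_neutral_right) auto
  then show ?thesis
    using assms(5) by simp
qed

context vector_mdp
begin

text \<open>Without a policy, \<open>V N s\<close> would be empty and the base case of the backward
  induction would fail.\<close>

lemma policies_nonempty: "policies \<noteq> {}"
  using actions_nonempty by (simp add: policies_def decision_rules_def PiE_eq_empty_iff)

lemma policies_update: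
  assumes "\<pi> \<in> policies" and "t \<in> {1..<N}" and "s \<in> S" and "a \<in> A s"
  shows "\<pi>(t := (\<pi> t)(s := a)) \<in> policies"
  using assms by (auto simp: policies_def decision_rules_def PiE_iff extensional_def)

text \<open>The recursion started at epoch \<open>t\<close> consults only the decision rules from
  \<open>t\<close> on.\<close>

lemma total_reward_cong:
  assumes "\<And>t'. t \<le> t' \<Longrightarrow> \<pi> t' = \<pi>' t'"
  shows "total_reward \<pi> t s = total_reward \<pi>' t s"
  using assms
proof (induction \<pi> t s rule: total_reward.induct)
  case (1 \<pi> t s)
  then have "total_reward \<pi> (t + 1) j = total_reward \<pi>' (t + 1) j" if "\<not> N \<le> t" "j \<in> S" for j
    using that by auto
  then show ?case
    using "1.prems"[of t]
    by (subst (1 2) total_reward.simps) (auto intro!: sum.cong)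
qed

lemma V_terminal: "V N s = {RN s}"
  using policies_nonempty by (auto simp: V_def total_reward.simps)

text \<open>\<open>W\<close> is left general so that the same step serves the induction for
  \<open>U\<close> and the final passage to \<open>F\<close>.\<close>

lemma one_step_subset_V:
  assumes deterministic: "\<And>a. a \<in> A s \<Longrightarrow> \<exists>k\<in>S. p t k s a = 1"
    and t: "t \<in> {1..<N}" and s: "s \<in> S"
    and W: "\<And>j. j \<in> S \<Longrightarrow> W j \<subseteq> V (t + 1) j"
  shows "one_step t W s \<subseteq> V t s"
proof
  fix x
  assume "x \<in> one_step t W s"
  then obtain a v where a: "a \<in> A s" and v: "\<And>j. j \<in> S \<Longrightarrow> v j \<in> W j"
    and x: "x = R t s a + (\<Sum>j\<in>S. p t j s a *\<^sub>R v j)"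
    by (auto simp: one_step_def)
  obtain k where k: "k \<in> S" "p t k s a = 1"
    using deterministic[OF a] by blast
  have sum_eq: "(\<Sum>j\<in>S. p t j s a *\<^sub>R f j) = f k" for f :: "'s \<Rightarrow> real ^ 'm"
    using finite_states prob_nonneg[OF t s a] prob_sum[OF t s a] k
    by (rule sum_scaleR_point_mass)
  \<comment> \<open>Only \<open>v k\<close> needs a policy; the values \<open>v j\<close> at other
    states are discarded by \<open>sum_eq\<close>.\<close>
  obtain \<pi> where \<pi>: "\<pi> \<in> policies" and vk: "v k = total_reward \<pi> (t + 1) k"
    using v[OF k(1)] W[OF k(1)] by (auto simp: V_def)
  define \<pi>' where "\<pi>' = \<pi>(t := (\<pi> t)(s := a))"
  \<comment> \<open>The comparison starts at epoch \<open>t + 1\<close>, so the change made at epoch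
    \<open>t\<close> is not seen, even if \<open>k = s\<close>.\<close>
  have "total_reward \<pi>' (t + 1) k = total_reward \<pi> (t + 1) k"
    by (rule total_reward_cong) (simp add: \<pi>'_def)
  then have "total_reward \<pi>' t s = x"
    using t by (subst total_reward.simps) (simp add: \<pi>'_def x sum_eq vk)
  moreover have "\<pi>' \<in> policies"
    unfolding \<pi>'_def using \<pi> t s a by (rule policies_update)
  ultimately show "x \<in> V t s"
    by (auto simp: V_def)
qed

text \<open>Backward induction from \<open>N\<close>: passing to efficient points only shrinks the
  one-step set, so \<open>one_step_subset_V\<close> carries the inclusion from \<open>t + 1\<close>
  to \<open>t\<close>.\<close>

lemma U_subset_V:
  assumes deterministic:
      "\<And>s a t. s \<in> S \<Longrightarrow> a \<in> A s \<Longrightarrow> t \<in> {1..<N} \<Longrightarrow> \<exists>k\<in>S. p t k s a = 1"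
    and "1 \<le> t" and "t \<le> N" and "s \<in> S"
  shows "U t s \<subseteq> V t s"
  using assms(3,2,4)
proof (induction t arbitrary: s rule: inc_induct)
  case base
  then show ?case
    by (simp add: U.simps V_terminal)
next
  case (step t)
  have "U t s \<subseteq> one_step t (U (t + 1)) s"
    using step.hyps by (subst U.simps) (auto simp: efficient_def)
  also have "\<dots> \<subseteq> V t s"
    using step by (intro one_step_subset_V deterministic) auto
  finally show ?case .
qed

text \<open>Since \<open>t + 1 \<le> N\<close>, the inclusion for \<open>U\<close> covers the
  continuations, and one further step gives \<open>F\<close>.\<close>

lemma F_subset_V:
  assumes "\<And>s a t. s \<in> S \<Longrightarrow> a \<in> A s \<Longrightarrow> t \<in> {1..<N} \<Longrightarrow> \<exists>k\<in>S. p t k s a = 1"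
    and "t \<in> {1..<N}" and "s \<in> S"
  shows "F t s \<subseteq> V t s"
  unfolding F_def using assms by (intro one_step_subset_V U_subset_V) auto

end

theorem theorem1:
  fixes N :: nat
    and S :: "'s set"
    and A :: "'s \<Rightarrow> 'a::topological_space set"
    and R :: "nat \<Rightarrow> 's \<Rightarrow> 'a \<Rightarrow> real ^ 'm"
    and p :: "nat \<Rightarrow> 's \<Rightarrow> 's \<Rightarrow> 'a \<Rightarrow> real"
    and RN :: "'s \<Rightarrow> real ^ 'm"
  assumes "vector_mdp N S A R p"
    and "N > 2"
    and deterministic: "\<And>s a t. s \<in> S \<Longrightarrow> a \<in> A s \<Longrightarrow> t \<in> {1..<N} \<Longrightarrow> \<exists>s'\<in>S. p t s' s a = 1"
  shows "\<forall>s\<in>S. \<forall>t\<in>{1..<N}. vector_mdp.F N S A R p RN t s \<subseteq> vector_mdp.V N S A R p RN t s"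
proof -
  interpret vector_mdp N S A R p RN
    by (fact assms(1))
  show ?thesis
    using F_subset_V[OF deterministic] by blast
qed

end
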